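(* For every integer $D$ with $0 \le D \le p$ (for the respective prime $p$), the following lower bounds hold: \[ W(3,\mathbb{Z}_5,D/5) \geq \frac{D^3 - 3D^2 + 2D}{6}, \] \[ W(3,\mathbb{Z}_7,D/7) \geq \frac{D^3 - 4D^2 + 3D}{8}, \] \[ W(3,\mathbb{Z}_{11},D/11) \geq \frac{\sqrt{5}D^3 + (15-12\sqrt{5})D^2 + (-15+11\sqrt{5})D}{30}, \] \[ W(3,\mathbb{Z}_{13},D/13) \geq \frac{21-2\sqrt{3}}{286}D^3 + \frac{28\sqrt{3}-151}{286}D^2 + \frac{5-\sqrt{3}}{11}D, \] \[ W(3,\mathbb{Z}_{17},D/17) \geq \frac{1}{24}D^3 - \frac{1}{4}D^2 + \frac{5}{24}D. \]
   Context: For a prime $p$, an arithmetic progression (A.P.) of length 3 in $\mathbb{Z}_p$ is a set of three distinct elements of the form $\{a, a+d, a+2d\}$ with $a \in \mathbb{Z}_p$, $d \in \mathbb{Z}_p\setminus\{0\}$; each such set is counted once. $W(3,\mathbb{Z}_p,D/p)$ denotes the minimum, over all subsets $S\subseteq\mathbb{Z}_p$ with $|S|=D$, of the number of 3-term A.P.s contained in $S$, i.e. $\min\{\sum_{\{i,j,k\}\text{ A.P. in }\mathbb{Z}_p} x_ix_jx_k : x_i\in\{0,1\}, \sum_{i=0}^{p-1}x_i = D\}$. *)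

theory Defs
  imports Complex_Main "HOL-Number_Theory.Residues"
begin

abbreviation Zmod :: "nat \<Rightarrow> int ring" where
  "Zmod p \<equiv> residue_ring (int p)"

(* Progressions are sets of residues, so the parameters (a, d) and (a + 2d, -d)
   yield one and the same progression. *)
definition three_term_APs :: "nat \<Rightarrow> int set set" where
  "three_term_APs p =
     {A. card A = 3 \<and>
         (\<exists>a\<in>carrier (Zmod p). \<exists>d\<in>carrier (Zmod p) - {\<zero>\<^bsub>Zmod p\<^esub>}.
            A = {a, a \<oplus>\<^bsub>Zmod p\<^esub> d, a \<oplus>\<^bsub>Zmod p\<^esub> (d \<oplus>\<^bsub>Zmod p\<^esub> d)})}"

(* W3 p D is W(3, Z_p, D/p): the density D/p is represented by the size D.
   The minimum is over a nonempty set exactly when D is at most p; larger D are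
   not meaningful. *)
definition W3 :: "nat \<Rightarrow> nat \<Rightarrow> nat" where
  "W3 p D = Min {card {A \<in> three_term_APs p. A \<subseteq> S} | S. S \<subseteq> carrier (Zmod p) \<and> card S = D}"

lemma W3_attained:
  assumes "D \<le> p"
  shows "\<exists>S. S \<subseteq> carrier (Zmod p) \<and> card S = D \<and> W3 p D = card {A \<in> three_term_APs p. A \<subseteq> S}"
proof -
  let ?M = "{card {A \<in> three_term_APs p. A \<subseteq> S} | S. S \<subseteq> carrier (Zmod p) \<and> card S = D}"
  have fin: "finite (carrier (Zmod p))" and crd: "card (carrier (Zmod p)) = p"
    by (simp_all add: residue_ring_def)
  have "?M \<subseteq> (\<lambda>S. card {A \<in> three_term_APs p. A \<subseteq> S}) ` Pow (carrier (Zmod p))"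
    by blast
  then have "finite ?M"
    using fin by (meson finite_Pow_iff finite_imageI finite_subset)
  moreover have "?M \<noteq> {}"
    using obtain_subset_with_card_n[of D "carrier (Zmod p)"] assms crd by (auto; metis)
  ultimately have "Min ?M \<in> ?M"
    by (rule Min_in)
  then show ?thesis
    unfolding W3_def by blast
qed

end

(*
  For S in Z_p let c(r) be the number of triples (a, b, c) in S with b distinct from a and
  c - a = r (b - a). Permuting the three points shows that c is constant on the orbits of
  r -> 1/r, r -> 1 - r; c(2) is twice the number of progressions, c(1) = D(D - 1), and
  the c(r) with r nonzero sum to D(D - 1)^2. Moreover, any autocorrelation K of a real function on the
  multiplicative group satisfies sum K(r) c(r) >= 0, being a sum of squares. With K a suitable
  real part of a multiplicative character (for p = 13 a combination of two of them), this
  inequality and the total eliminate the other orbits and bound c(2) from below.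
*)

theory Submission
  imports Defs
begin

section \<open>Sums over residues under translations and dilations\<close>

lemma sum_shift_mod:
  fixes f :: "int \<Rightarrow> 'a::comm_monoid_add"
  assumes "p > 0" and per: "\<And>i. f (i mod p) = f i"
  shows "(\<Sum>a\<in>{0..<p}. f (a + c)) = (\<Sum>a\<in>{0..<p}. f a)"
proof (rule sum.reindex_bij_witness[where i = "\<lambda>a. (a - c) mod p" and j = "\<lambda>a. (a + c) mod p"])
  fix a assume a: "a \<in> {0..<p}"
  show "((a + c) mod p - c) mod p = a" "((a - c) mod p + c) mod p = a"
    using a by (simp_all add: mod_simps)
  show "f ((a + c) mod p) = f (a + c)" by (rule per)
qed (use assms in auto)

text \<open>Multiplication by a unit \<open>m\<close> permutes the nonzero residues; multiplication
  by its inverse \<open>n\<close> undoes it.\<close>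

lemma sum_scale_mod:
  fixes f :: "int \<Rightarrow> 'a::comm_monoid_add"
  assumes p: "p > 1" and per: "\<And>i. f (i mod p) = f i" and cop: "coprime m p"
  shows "(\<Sum>d\<in>{1..<p}. f (m * d)) = (\<Sum>d\<in>{1..<p}. f d)"
proof -
  obtain n where n: "[m * n = 1] (mod p)"
    using cop coprime_iff_invertible_int by blast
  have cop': "coprime n p"
    using n coprime_iff_invertible_int by (metis mult.commute)
  have nz: "(k * d) mod p \<in> {1..<p}" if "coprime k p" "d \<in> {1..<p}" for k d
  proof -
    have "\<not> p dvd d" using that(2) by (auto dest: zdvd_imp_le)
    then have "\<not> p dvd k * d"
      using that(1) by (simp add: coprime_commute coprime_dvd_mult_right_iff)
    then have "(k * d) mod p \<noteq> 0" by (simp add: dvd_eq_mod_eq_0)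
    moreover have "0 \<le> (k * d) mod p" "(k * d) mod p < p" using p by simp_all
    ultimately show ?thesis by simp
  qed
  have inv: "(n * ((m * d) mod p)) mod p = d" "(m * ((n * d) mod p)) mod p = d"
    if "d \<in> {1..<p}" for d
  proof -
    have "[m * n * d = 1 * d] (mod p)" using n by (rule cong_mult) simp
    then have "(m * n * d) mod p = d" using that by (simp add: cong_def)
    then show "(n * ((m * d) mod p)) mod p = d" "(m * ((n * d) mod p)) mod p = d"
      by (simp_all add: mod_mult_right_eq ac_simps)
  qed
  show ?thesis
  proof (rule sum.reindex_bij_witness
      [where i = "\<lambda>d. (n * d) mod p" and j = "\<lambda>d. (m * d) mod p"])
    fix d assume d: "d \<in> {1..<p}"
    show "f ((m * d) mod p) = f (m * d)" by (rule per)
  qed (use nz inv cop cop' in blast)+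
qed

text \<open>As a rewrite rule this unrolls an interval with numeral bounds, so that a sum over all
  ratios becomes an explicit expression.\<close>

lemma atLeastLessThan_int_rec:
  "{a..<b::int} = (if a < b then insert a {a + 1..<b} else {})"
  by auto

section \<open>Counting triples of a subset of Z_p by their ratio\<close>

text \<open>The condition \<open>p > 3\<close> makes 2 and 3 units: then the terms of a progression
  are distinct, and their sum determines the middle one.\<close>

locale residue_subset =
  fixes p :: nat and S :: "int set"
  assumes prime: "prime p" and gt3: "p > 3" and S: "S \<subseteq> {0..<int p}"
begin

text \<open>Reducing the argument makes the indicator periodic on all integers, so points such as
  \<open>a + r * d\<close> need no explicit reduction.\<close>

definition ind :: "int \<Rightarrow> real" where
  "ind i = of_bool (i mod int p \<in> S)"

text \<open>Counts the triples \<open>(a, b, c)\<close> in \<open>S\<close> with \<open>b \<noteq> a\<close> and \<open>c - a = r (b - a)\<close>.\<close>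

definition config :: "int \<Rightarrow> real" where
  "config r = (\<Sum>a\<in>{0..<int p}. \<Sum>d\<in>{1..<int p}. ind a * ind (a + d) * ind (a + r * d))"

definition D :: real where "D = real (card S)"

definition aps :: nat where "aps = card {A \<in> three_term_APs p. A \<subseteq> S}"

lemma ind_cong: "i mod int p = j mod int p \<Longrightarrow> ind i = ind j"
  by (simp add: ind_def)

lemma ind_idem: "ind i * ind i = ind i"
  by (simp add: ind_def)

lemma finite_S: "finite S"
  using S by (rule finite_subset) simp

lemma coprime_nonzero: "d \<in> {1..<int p} \<Longrightarrow> coprime d (int p)"
  using prime by (metis atLeastLessThan_iff coprime_commute linorder_not_le prime_imp_coprime
      prime_int_nat_transfer nat_int zdvd_imp_le zero_less_one order_less_le_trans
      prime_nat_int_transfer)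

lemma sum_shift:
  assumes "\<And>i j. i mod int p = j mod int p \<Longrightarrow> f i = f j"
  shows "(\<Sum>a\<in>{0..<int p}. f (a + c)) = (\<Sum>a\<in>{0..<int p}. f a :: real)"
  using gt3 by (intro sum_shift_mod assms) auto

lemma sum_scale:
  assumes "\<And>i j. i mod int p = j mod int p \<Longrightarrow> f i = f j" "coprime m (int p)"
  shows "(\<Sum>d\<in>{1..<int p}. f (m * d)) = (\<Sum>d\<in>{1..<int p}. f d :: real)"
  using gt3 by (intro sum_scale_mod assms) auto

lemma sum_ind: "(\<Sum>a\<in>{0..<int p}. ind a) = D"
proof -
  have "(\<Sum>a\<in>{0..<int p}. ind a) = (\<Sum>a\<in>{0..<int p}. of_bool (a \<in> S))"
    by (intro sum.cong) (auto simp: ind_def)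
  also have "\<dots> = D"
    using S by (simp add: D_def Int_absorb1)
  finally show ?thesis .
qed

lemma sum_ind_shifted: "(\<Sum>d\<in>{1..<int p}. ind (a + d)) = D - ind a"
proof -
  have "D = (\<Sum>d\<in>{0..<int p}. ind (d + a))"
    unfolding sum_ind[symmetric] by (rule sum_shift[symmetric]) (rule ind_cong)
  also have "{0..<int p} = insert 0 {1..<int p}" using gt3 by auto
  finally show ?thesis by (simp add: add.commute)
qed

text \<open>At ratio 1 the last two points coincide, which leaves ordered pairs of distinct elements
  of \<open>S\<close>.\<close>

lemma config_1: "config 1 = D * (D - 1)"
proof -
  have "config 1 = (\<Sum>a\<in>{0..<int p}. ind a * (D - ind a))"
    unfolding config_def by (simp add: mult.assoc ind_idem sum_ind_shifted flip: sum_distrib_left)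
  also have "\<dots> = (\<Sum>a\<in>{0..<int p}. ind a * (D - 1))"
    by (simp add: right_diff_distrib ind_idem)
  finally show ?thesis by (simp add: sum_ind flip: sum_distrib_right)
qed

text \<open>For fixed \<open>a\<close> and \<open>d\<close> the point \<open>a + r * d\<close> runs
  over all residues except \<open>a\<close>. Hence the second and third points are chosen
  independently from the rest of \<open>S\<close>.\<close>

lemma config_sum: "(\<Sum>r\<in>{1..<int p}. config r) = D * (D - 1)\<^sup>2"
proof -
  have "(\<Sum>r\<in>{1..<int p}. config r) =
     (\<Sum>a\<in>{0..<int p}. \<Sum>r\<in>{1..<int p}. \<Sum>d\<in>{1..<int p}. ind a * ind (a + d) * ind (a + r * d))"
    unfolding config_def by (rule sum.swap)
  also have "\<dots> = (\<Sum>a\<in>{0..<int p}. \<Sum>d\<in>{1..<int p}. \<Sum>r\<in>{1..<int p}. ind a * ind (a + d) * ind (a + r * d))"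
    by (rule sum.cong[OF refl], rule sum.swap)
  also have "\<dots> = (\<Sum>a\<in>{0..<int p}. \<Sum>d\<in>{1..<int p}. ind a * ind (a + d) * (D - ind a))"
  proof (intro sum.cong refl)
    fix a d assume d: "d \<in> {1..<int p}"
    have "(\<Sum>r\<in>{1..<int p}. ind (a + r * d)) = (\<Sum>r\<in>{1..<int p}. ind (a + d * r))"
      by (simp add: mult.commute)
    also have "\<dots> = (\<Sum>r\<in>{1..<int p}. ind (a + r))"
      by (rule sum_scale[where f = "\<lambda>r. ind (a + r)"])
         (auto intro!: ind_cong coprime_nonzero d mod_add_cong)
    finally have "(\<Sum>r\<in>{1..<int p}. ind (a + r * d)) = D - ind a"
      by (simp add: sum_ind_shifted)
    then show "(\<Sum>r\<in>{1..<int p}. ind a * ind (a + d) * ind (a + r * d))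
        = ind a * ind (a + d) * (D - ind a)"
      by (simp flip: sum_distrib_left)
  qed
  also have "\<dots> = (\<Sum>a\<in>{0..<int p}. ind a * (D - ind a) * (D - ind a))"
    by (simp add: sum_ind_shifted flip: sum_distrib_left sum_distrib_right)
  also have "\<dots> = (\<Sum>a\<in>{0..<int p}. ind a * (D - 1)\<^sup>2)"
    by (intro sum.cong refl) (auto simp: ind_def power2_eq_square)
  finally show ?thesis by (simp add: sum_ind flip: sum_distrib_right)
qed

section \<open>Symmetries and positivity of the ratio counts\<close>

lemma config_cong:
  assumes "r mod int p = s mod int p"
  shows "config r = config s"
proof -
  have "ind (a + r * d) = ind (a + s * d)" for a d
    using assms by (intro ind_cong mod_add_cong mod_mult_cong refl)
  then show ?thesis by (simp add: config_def)
qed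

text \<open>Exchanging the first two points of a triple replaces the ratio \<open>r\<close> by \<open>1 - r\<close>.\<close>

lemma config_reflect: "config (1 - r) = config r"
proof -
  have per: "i mod int p = j mod int p \<Longrightarrow> ind (i + k) = ind (j + k)" for i j k
    by (intro ind_cong mod_add_cong refl)
  have per2: "i mod int p = j mod int p \<Longrightarrow> ind (k + l * i) = ind (k + l * j)" for i j k l
    by (intro ind_cong mod_add_cong mod_mult_cong refl)
  have "config r = (\<Sum>d\<in>{1..<int p}. \<Sum>a\<in>{0..<int p}. ind a * ind (a + d) * ind (a + r * d))"
    unfolding config_def by (rule sum.swap)
  \<comment> \<open>The base point is moved by \<open>- d\<close>. The new difference is written
    \<open>(-1) * d\<close> so that \<open>sum_scale\<close> can absorb the sign next.\<close>
  also have "\<dots> = (\<Sum>d\<in>{1..<int p}. \<Sum>a\<in>{0..<int p}. ind (a + (-1) * d) * ind a * ind (a + (1 - r) * ((-1) * d)))"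
  proof (rule sum.cong[OF refl])
    fix d
    have "(\<Sum>a\<in>{0..<int p}. ind a * ind (a + d) * ind (a + r * d)) =
       (\<Sum>a\<in>{0..<int p}. ind (a + (-d)) * ind (a + (-d) + d) * ind (a + (-d) + r * d))"
      by (rule sum_shift[symmetric, where f = "\<lambda>a. ind a * ind (a + d) * ind (a + r * d)"])
         (metis per ind_cong)
    then show "(\<Sum>a\<in>{0..<int p}. ind a * ind (a + d) * ind (a + r * d)) =
       (\<Sum>a\<in>{0..<int p}. ind (a + (-1) * d) * ind a * ind (a + (1 - r) * ((-1) * d)))"
      by (simp add: algebra_simps)
  qed
  also have "\<dots> = (\<Sum>d\<in>{1..<int p}. \<Sum>a\<in>{0..<int p}. ind (a + d) * ind a * ind (a + (1 - r) * d))"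
    by (rule sum_scale[where f = "\<lambda>d. \<Sum>a\<in>{0..<int p}. ind (a + d) * ind a * ind (a + (1 - r) * d)"])
       (auto intro!: sum.cong arg_cong2[where f = "(*)"] per2 ind_cong mod_add_cong mod_mult_cong)
  also have "\<dots> = config (1 - r)"
    unfolding config_def by (subst sum.swap) (simp add: ac_simps)
  finally show ?thesis by simp
qed

lemma config_reflect_cong:
  assumes "[r + s = 1] (mod int p)"
  shows "config r = config s"
proof -
  have "[1 - s = r + s - s] (mod int p)"
    using assms by (intro cong_diff cong_refl) (simp add: cong_sym_eq)
  then have "config r = config (1 - s)"
    by (intro config_cong) (simp add: cong_def)
  then show ?thesis by (simp add: config_reflect)
qed

text \<open>Exchanging the last two points inverts the ratio: replacing \<open>d\<close> by
  \<open>s * d\<close> turns \<open>a + r * d\<close> into \<open>a + d\<close> and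
  \<open>a + d\<close> into \<open>a + s * d\<close>.\<close>

lemma config_inverse:
  assumes "[r * s = 1] (mod int p)"
  shows "config r = config s"
proof -
  have cop: "coprime s (int p)"
    using assms coprime_iff_invertible_int by (metis mult.commute)
  have "(\<Sum>d\<in>{1..<int p}. ind a * ind (a + d) * ind (a + r * d)) =
        (\<Sum>d\<in>{1..<int p}. ind a * ind (a + d) * ind (a + s * d))" for a
  proof -
    have "(\<Sum>d\<in>{1..<int p}. ind a * ind (a + d) * ind (a + r * d)) =
          (\<Sum>d\<in>{1..<int p}. ind a * ind (a + s * d) * ind (a + r * (s * d)))"
      by (rule sum_scale[symmetric, where f = "\<lambda>d. ind a * ind (a + d) * ind (a + r * d)"])
         (auto intro!: cop arg_cong2[where f = "(*)"] ind_cong mod_add_cong mod_mult_cong)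
    moreover have "ind (a + r * (s * d)) = ind (a + d)" for d
    proof (rule ind_cong)
      have "[a + r * s * d = a + 1 * d] (mod int p)"
        using assms by (intro cong_add cong_mult) auto
      then show "(a + r * (s * d)) mod int p = (a + d) mod int p"
        by (simp add: cong_def mult.assoc)
    qed
    ultimately show ?thesis by (simp add: mult.commute mult.left_commute)
  qed
  then show ?thesis by (simp only: config_def)
qed

text \<open>The left-hand side is the sum over \<open>a \<in> S\<close> and over all dilations \<open>m\<close> of the squares
  \<open>(\<Sum>d. \<phi> (d m) ind (a + d))\<^sup>2\<close>, expanded with the second index written as \<open>r d\<close>.\<close>

lemma autocorrelation_nonneg:
  fixes \<phi> :: "int \<Rightarrow> real"
  assumes per: "\<And>i j. i mod int p = j mod int p \<Longrightarrow> \<phi> i = \<phi> j"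
  shows "(\<Sum>r\<in>{1..<int p}. (\<Sum>m\<in>{1..<int p}. \<phi> m * \<phi> (r * m)) * config r) \<ge> 0"
proof -
  let ?P = "{1..<int p}" and ?Z = "{0..<int p}"
  have square: "(\<Sum>d\<in>?P. \<phi> (d * m) * ind (a + d))\<^sup>2 =
     (\<Sum>d\<in>?P. \<Sum>r\<in>?P. \<phi> (d * m) * ind (a + d) * (\<phi> (r * (d * m)) * ind (a + r * d)))" for a m
  proof -
    have "(\<Sum>d\<in>?P. \<phi> (d * m) * ind (a + d))\<^sup>2 =
       (\<Sum>d\<in>?P. \<phi> (d * m) * ind (a + d) * (\<Sum>e\<in>?P. \<phi> (e * m) * ind (a + e)))"
      by (simp add: power2_eq_square flip: sum_distrib_right)
    also have "\<dots> = (\<Sum>d\<in>?P. \<phi> (d * m) * ind (a + d) *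
        (\<Sum>r\<in>?P. \<phi> (d * r * m) * ind (a + d * r)))"
    proof (rule sum.cong[OF refl], rule arg_cong2[where f = "(*)", OF refl])
      fix d assume d: "d \<in> ?P"
      show "(\<Sum>e\<in>?P. \<phi> (e * m) * ind (a + e)) = (\<Sum>r\<in>?P. \<phi> (d * r * m) * ind (a + d * r))"
        by (rule sum_scale[symmetric, where f = "\<lambda>e. \<phi> (e * m) * ind (a + e)"])
           (auto intro!: coprime_nonzero d arg_cong2[where f = "(*)"] per ind_cong mod_add_cong
              mod_mult_cong)
    qed
    finally show ?thesis
      by (simp add: sum_distrib_left ac_simps)
  qed
  \<comment> \<open>Averaging over all dilations \<open>m\<close> removes \<open>d\<close> from the
    coefficient, which then depends on the ratio \<open>r\<close> alone.\<close>
  have scaled: "(\<Sum>m\<in>?P. \<phi> (d * m) * \<phi> (r * (d * m))) = (\<Sum>m\<in>?P. \<phi> m * \<phi> (r * m))"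
    if "d \<in> ?P" for d r
    by (rule sum_scale[where f = "\<lambda>m. \<phi> m * \<phi> (r * m)"])
       (auto intro!: coprime_nonzero that arg_cong2[where f = "(*)"] per mod_mult_cong)
  have "0 \<le> (\<Sum>m\<in>?P. \<Sum>a\<in>?Z. ind a * (\<Sum>d\<in>?P. \<phi> (d * m) * ind (a + d))\<^sup>2)"
    by (intro sum_nonneg mult_nonneg_nonneg) (auto simp: ind_def)
  also have "\<dots> = (\<Sum>m\<in>?P. \<Sum>a\<in>?Z. \<Sum>d\<in>?P. \<Sum>r\<in>?P.
      \<phi> (d * m) * \<phi> (r * (d * m)) * (ind a * ind (a + d) * ind (a + r * d)))"
    by (simp only: square sum_distrib_left) (simp only: ac_simps)
  also have "\<dots> = (\<Sum>a\<in>?Z. \<Sum>d\<in>?P. \<Sum>r\<in>?P. \<Sum>m\<in>?P.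
      \<phi> (d * m) * \<phi> (r * (d * m)) * (ind a * ind (a + d) * ind (a + r * d)))"
    by (rule trans[OF sum.swap], rule sum.cong[OF refl],
        rule trans[OF sum.swap], rule sum.cong[OF refl], rule sum.swap)
  also have "\<dots> = (\<Sum>a\<in>?Z. \<Sum>d\<in>?P. \<Sum>r\<in>?P.
      (\<Sum>m\<in>?P. \<phi> m * \<phi> (r * m)) * (ind a * ind (a + d) * ind (a + r * d)))"
    by (intro sum.cong refl) (simp add: scaled flip: sum_distrib_right)
  also have "\<dots> = (\<Sum>a\<in>?Z. \<Sum>r\<in>?P. \<Sum>d\<in>?P.
      (\<Sum>m\<in>?P. \<phi> m * \<phi> (r * m)) * (ind a * ind (a + d) * ind (a + r * d)))"
    by (rule sum.cong[OF refl], rule sum.swap)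
  also have "\<dots> = (\<Sum>r\<in>?P. \<Sum>a\<in>?Z. \<Sum>d\<in>?P.
      (\<Sum>m\<in>?P. \<phi> m * \<phi> (r * m)) * (ind a * ind (a + d) * ind (a + r * d)))"
    by (rule sum.swap)
  also have "\<dots> = (\<Sum>r\<in>?P. (\<Sum>m\<in>?P. \<phi> m * \<phi> (r * m)) * config r)"
    by (simp only: config_def sum_distrib_left)
  finally show ?thesis .
qed

section \<open>From ratio counts to progressions\<close>

text \<open>Up to sign the pairwise differences are \<open>d\<close>, \<open>d\<close> and
  \<open>2 * d\<close>, none divisible by the odd prime \<open>p\<close>.\<close>

lemma middle_triple_card:
  assumes d: "d \<in> {1..<int p}"
  shows "card {a mod int p, (a + d) mod int p, (a - d) mod int p} = 3"
proof -
  have nd: "\<not> int p dvd d"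
    using d by (auto dest: zdvd_imp_le)
  moreover have "\<not> int p dvd 2 * d"
  proof
    assume "int p dvd 2 * d"
    then have "int p dvd 2"
      using nd prime prime_dvd_mult_iff[of "int p" 2 d] by simp
    then show False using gt3 by (auto dest: zdvd_imp_le)
  qed
  ultimately have "a mod int p \<noteq> (a + d) mod int p" "a mod int p \<noteq> (a - d) mod int p"
    "(a + d) mod int p \<noteq> (a - d) mod int p"
    by (auto simp: mod_eq_dvd_iff dvd_minus_iff)
  then show ?thesis by simp
qed

lemma middle_triple_AP:
  assumes a: "a \<in> {0..<int p}" and d: "d \<in> {1..<int p}"
  shows "{a, (a + d) mod int p, (a - d) mod int p} \<in> three_term_APs p"
proof -
  have a': "a mod int p = a" using a by simp
  have "(a - d) mod int p \<in> carrier (Zmod p)" "d \<in> carrier (Zmod p) - {\<zero>\<^bsub>Zmod p\<^esub>}"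
    using d gt3 by (auto simp: residue_ring_def)
  moreover have "(a - d) mod int p \<oplus>\<^bsub>Zmod p\<^esub> d = a"
    "(a - d) mod int p \<oplus>\<^bsub>Zmod p\<^esub> (d \<oplus>\<^bsub>Zmod p\<^esub> d) = (a + d) mod int p"
    by (simp_all add: residue_ring_def mod_simps a' add.commute)
  then have "{a, (a + d) mod int p, (a - d) mod int p} = {(a - d) mod int p,
    (a - d) mod int p \<oplus>\<^bsub>Zmod p\<^esub> d, (a - d) mod int p \<oplus>\<^bsub>Zmod p\<^esub> (d \<oplus>\<^bsub>Zmod p\<^esub> d)}"
    by auto
  ultimately show ?thesis
    using middle_triple_card[OF d, of a] a' unfolding three_term_APs_def by auto
qed

text \<open>By reflection \<open>config 2\<close> equals \<open>config (-1)\<close>, the number of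
  pairs \<open>(a, d)\<close> with \<open>a - d\<close>, \<open>a\<close>, \<open>a + d\<close> all
  in \<open>S\<close> modulo \<open>p\<close>. A progression arises from at most two of them, which
  differ in the sign of \<open>d\<close>.\<close>

lemma config_2_le: "config 2 \<le> 2 * real aps"
proof -
  define P where "P = {A \<in> three_term_APs p. A \<subseteq> S}"
  define E where "E = {(a, d). a \<in> {0..<int p} \<and> d \<in> {1..<int p} \<and>
    a \<in> S \<and> (a + d) mod int p \<in> S \<and> (a - d) mod int p \<in> S}"
  define triple where "triple = (\<lambda>(a, d). {a, (a + d) mod int p, (a - d) mod int p})"
  have finP: "finite P"
    using finite_S by (intro finite_subset[of P "Pow S"]) (auto simp: P_def)
  have E_sub: "E \<subseteq> {0..<int p} \<times> {1..<int p}" by (auto simp: E_def)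
  then have finE: "finite E" by (rule finite_subset) simp
  have "config (-1) = (\<Sum>x\<in>{0..<int p} \<times> {1..<int p}. of_bool (x \<in> E))"
    unfolding config_def sum.cartesian_product
    by (intro sum.cong refl) (auto simp: ind_def E_def)
  also have "\<dots> = real (card E)"
    using E_sub by (simp add: Int_absorb1)
  finally have config_E: "config (-1) = real (card E)" .
  have maps: "triple x \<in> P" if "x \<in> E" for x
    using that middle_triple_AP by (auto simp: E_def P_def triple_def)
  \<comment> \<open>The residues in a progression sum to three times its middle term, so the middle is determined.\<close>
  have fibre: "card {x \<in> E. triple x = A} \<le> 2" for A
  proof (cases "{x \<in> E. triple x = A} = {}")
    case False
    then obtain a d where ad: "(a, d) \<in> E" "triple (a, d) = A" by auto
    have A3: "card A = 3" "finite A" "a \<in> A"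
      using ad middle_triple_card[of d a] by (auto simp: E_def triple_def)
    have mid: "[3 * b = \<Sum>A] (mod int p)" if "(b, e) \<in> E" "triple (b, e) = A" for b e
    proof -
      let ?u = "(b + e) mod int p" and ?v = "(b - e) mod int p"
      have "card {b, ?u, ?v} = 3"
        using that middle_triple_card[of e b] by (auto simp: E_def)
      then have "b \<noteq> ?u" "b \<noteq> ?v" "?u \<noteq> ?v"
        by (auto simp: card_insert_if split: if_splits)
      then have "\<Sum>A = b + (?u + ?v)"
        using that(2) by (simp add: triple_def flip: that(2))
      moreover have "[b + (?u + ?v) = b + ((b + e) + (b - e))] (mod int p)"
        by (intro cong_add cong_refl) (auto simp: cong_def)
      ultimately show ?thesis by (simp add: cong_sym_eq)
    qed
    have uniq: "b = a" if "(b, e) \<in> E" "triple (b, e) = A" for b e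
    proof -
      have "[3 * b = 3 * a] (mod int p)"
        using mid[OF that] mid[OF ad] by (metis cong_sym cong_trans)
      moreover have "coprime 3 (int p)"
        using gt3 by (intro coprime_nonzero) simp
      ultimately have "[b = a] (mod int p)" using cong_mult_lcancel by blast
      then show ?thesis
        using that ad by (auto simp: E_def cong_def)
    qed
    \<comment> \<open>With the middle term fixed at \<open>a\<close>, a pair is determined by its
      term \<open>b + e\<close>, one of the two elements of \<open>A - {a}\<close>.\<close>
    have "inj_on (\<lambda>(b, e). (b + e) mod int p) {x \<in> E. triple x = A}"
    proof (rule inj_onI)
      fix x y
      assume *: "x \<in> {x \<in> E. triple x = A}" "y \<in> {x \<in> E. triple x = A}"
        and eq: "(case x of (b, e) \<Rightarrow> (b + e) mod int p) = (case y of (b, e) \<Rightarrow> (b + e) mod int p)"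
      have xy: "x = (a, snd x)" "y = (a, snd y)"
        using * uniq[of "fst x" "snd x"] uniq[of "fst y" "snd y"] by (simp_all add: prod_eq_iff)
      have "[a + snd x = a + snd y] (mod int p)"
        using eq by (subst (asm) xy(1), subst (asm) xy(2)) (simp add: cong_def)
      then have "[snd x = snd y] (mod int p)" by (simp add: cong_add_lcancel)
      then have "snd x = snd y"
        using * by (auto simp: E_def cong_def)
      then show "x = y" using xy by simp
    qed
    moreover have "(\<lambda>(b, e). (b + e) mod int p) ` {x \<in> E. triple x = A} \<subseteq> A - {a}"
    proof clarify
      fix b e assume *: "(b, e) \<in> E" "A = triple (b, e)"
      then have b: "b = a" using uniq by blast
      have "card {b, (b + e) mod int p, (b - e) mod int p} = 3"
        using * middle_triple_card[of e b] by (auto simp: E_def)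
      then have "(b + e) mod int p \<noteq> b"
        by (auto simp: card_insert_if split: if_splits)
      then show "(b + e) mod int p \<in> triple (b, e) - {a}"
        using b by (simp add: triple_def)
    qed
    ultimately have "card {x \<in> E. triple x = A} \<le> card (A - {a})"
      using A3 by (meson card_inj_on_le finite_Diff)
    then show ?thesis using A3 by simp
  next
    case True
    then show ?thesis by (simp only: card.empty)
  qed
  have "E = (\<Union>A\<in>P. {x \<in> E. triple x = A})" using maps by blast
  then have "card E = card (\<Union>A\<in>P. {x \<in> E. triple x = A})" by (rule arg_cong)
  also have "\<dots> \<le> (\<Sum>A\<in>P. card {x \<in> E. triple x = A})"
    using finP by (rule card_UN_le)
  also have "\<dots> \<le> (\<Sum>A\<in>P. 2)" by (intro sum_mono fibre)
  finally show ?thesis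
    using config_reflect[of 2] by (simp add: config_E aps_def P_def)
qed

section \<open>The bounds for the individual primes\<close>

text \<open>The ratios 2, 3, 4 form a single orbit, so the total alone fixes
  \<open>config 2\<close>. The bound is the binomial coefficient of \<open>D\<close> over 3: every
  3-subset of Z_5 is a progression.\<close>

lemma aps_ge_5:
  assumes p: "p = 5"
  shows "(D ^ 3 - 3 * D ^ 2 + 2 * D) / 6
    \<le> real aps"
proof -
  have p_int: "int p = 5" by (simp add: p)
  have range: "{1..<5::int} = {1, 2, 3, 4}"
    by (simp add: atLeastLessThan_int_rec)
  have inverse: "config 2 = config 3"
    by (rule config_inverse; simp add: p_int cong_def)+
  have reflect: "config 2 = config 4"
    by (rule config_reflect_cong; simp add: p_int cong_def)+
  have orbits: "config 3 = config 2" "config 4 = config 2"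
    using inverse reflect by linarith+
  have total: "config 1 + 3 * config 2 = D * (D - 1)\<^sup>2"
    using config_sum by (simp add: p_int range orbits)
  have one: "config 1 = D * (D - 1)"
    by (rule config_1)
  show ?thesis
    using total config_2_le
    by (simp add: one algebra_simps power2_eq_square power3_eq_cube)
qed

text \<open>The weight \<open>\<phi>\<close> chosen for 7 and 17 is the quadratic character. For 11 it is
  \<open>4 cos (2 \<pi> k / 5)\<close> at \<open>2\<^sup>k\<close>, and for 13 the two weights are \<open>2 cos (\<pi> k / 6)\<close> and
  \<open>2 cos (\<pi> k / 3)\<close> at \<open>2\<^sup>k\<close>.\<close>

lemma aps_ge_7:
  assumes p: "p = 7"
  shows "(D ^ 3 - 4 * D ^ 2 + 3 * D) / 8
    \<le> real aps"
proof -
  have p_int: "int p = 7" by (simp add: p)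
  have range: "{1..<7::int} = {1, 2, 3, 4, 5, 6}"
    by (simp add: atLeastLessThan_int_rec)
  have inverse: "config 2 = config 4" "config 3 = config 5"
    by (rule config_inverse; simp add: p_int cong_def)+
  have reflect: "config 2 = config 6"
    by (rule config_reflect_cong; simp add: p_int cong_def)+
  have orbits: "config 4 = config 2" "config 6 = config 2" "config 5 = config 3"
    using inverse reflect by linarith+
  have total: "config 1 + 3 * config 2 + 2 * config 3 = D * (D - 1)\<^sup>2"
    using config_sum by (simp add: p_int range orbits)
  have one: "config 1 = D * (D - 1)"
    by (rule config_1)
  \<comment> \<open>The autocorrelation of the quadratic character is 6 times the character; this
    factor is cancelled here.\<close>
  have pos: "0 \<le> config 1 + config 2 - 2 * config 3"
    using autocorrelation_nonneg[of "\<lambda>i. [0, 1, 1, -1, 1, -1, -1] ! nat (i mod 7)"]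
    by (simp add: p_int range orbits algebra_simps)
  show ?thesis
    using total config_2_le pos
    by (simp add: one algebra_simps power2_eq_square power3_eq_cube)
qed

text \<open>Besides 1 there are two orbits, {2, 6, 10} and the other six ratios, so one
  autocorrelation inequality suffices to eliminate \<open>config 3\<close>.\<close>

lemma aps_ge_11:
  assumes p: "p = 11"
  shows "(sqrt 5 * D ^ 3 + (15 - 12 * sqrt 5) * D ^ 2
      + (- 15 + 11 * sqrt 5) * D) / 30
    \<le> real aps"
proof -
  have p_int: "int p = 11" by (simp add: p)
  define s where "s = sqrt 5"
  have s2: "s * s = 5" by (simp add: s_def)
  \<comment> \<open>Covers right-nested products, in which \<open>s2\<close> finds no instance of
    \<open>s * s\<close>.\<close>
  have s3: "s * (s * x) = 5 * x" for x by (simp add: s2 flip: mult.assoc)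
  have range: "{1..<11::int} = {1, 2, 3, 4, 5, 6, 7, 8, 9, 10}"
    by (simp add: atLeastLessThan_int_rec)
  have inverse: "config 2 = config 6" "config 3 = config 4" "config 5 = config 9" "config 7 = config 8"
    by (rule config_inverse; simp add: p_int cong_def)+
  have reflect: "config 2 = config 10" "config 3 = config 9" "config 4 = config 8"
    by (rule config_reflect_cong; simp add: p_int cong_def)+
  have orbits: "config 6 = config 2" "config 10 = config 2" "config 4 = config 3"
    "config 5 = config 3" "config 7 = config 3" "config 8 = config 3" "config 9 = config 3"
    using inverse reflect by linarith+
  have total: "config 1 + 3 * config 2 + 6 * config 3 = D * (D - 1)\<^sup>2"
    using config_sum by (simp add: p_int range orbits)
  have one: "config 1 = D * (D - 1)"
    by (rule config_1)
  have pos: "0 \<le> 2 * config 1 + (1 + s) * config 2 - (3 + s) * config 3"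
    using autocorrelation_nonneg[of "\<lambda>i.
      [0, 4, s - 1, - 1 - s, - 1 - s, s - 1, s - 1, - 1 - s, - 1 - s, s - 1, 4] ! nat (i mod 11)"]
    by (simp add: p_int range orbits algebra_simps s2 s3)
  have "s \<ge> 2" unfolding s_def by (rule real_le_rsqrt) simp
  \<comment> \<open>Since \<open>(3 * s - 5) * (3 + s) = 4 * s\<close> and
    \<open>(3 * s - 5) * (1 + s) = 10 - 2 * s\<close>, eliminating \<open>config 3\<close> by the
    total leaves \<open>config 2\<close> with the rational coefficient 10.\<close>
  then have "0 \<le> (3 * s - 5) * (2 * config 1 + (1 + s) * config 2 - (3 + s) * config 3)"
    using pos by (intro mult_nonneg_nonneg) auto
  moreover have "config 3 = (D * (D - 1)\<^sup>2 - config 1 - 3 * config 2) / 6"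
    using total by simp
  ultimately show ?thesis
    using config_2_le unfolding s_def[symmetric]
    by (simp add: one field_simps power2_eq_square power3_eq_cube s2 s3)
qed

text \<open>The ratios 4 and 10 form an extra orbit of size two, so two autocorrelation inequalities
  are combined to eliminate both \<open>config 3\<close> and \<open>config 4\<close>.\<close>

lemma aps_ge_13:
  assumes p: "p = 13"
  shows "(21 - 2 * sqrt 3) / 286 * D ^ 3
      + (28 * sqrt 3 - 151) / 286 * D ^ 2 + (5 - sqrt 3) / 11 * D
    \<le> real aps"
proof -
  have p_int: "int p = 13" by (simp add: p)
  define s where "s = sqrt 3"
  have s2: "s * s = 3" by (simp add: s_def)
  have s3: "s * (s * x) = 3 * x" for x by (simp add: s2 flip: mult.assoc)
  have range: "{1..<13::int} = {1, 2, 3, 4, 5, 6, 7, 8, 9, 10, 11, 12}"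
    by (simp add: atLeastLessThan_int_rec)
  have inverse: "config 2 = config 7" "config 3 = config 9" "config 5 = config 8"
    "config 6 = config 11" "config 4 = config 10"
    by (rule config_inverse; simp add: p_int cong_def)+
  have reflect: "config 2 = config 12" "config 3 = config 11" "config 5 = config 9"
    by (rule config_reflect_cong; simp add: p_int cong_def)+
  have orbits: "config 7 = config 2" "config 12 = config 2" "config 5 = config 3"
    "config 6 = config 3" "config 8 = config 3" "config 9 = config 3" "config 11 = config 3"
    "config 10 = config 4"
    using inverse reflect by linarith+
  have total: "config 1 + 3 * config 2 + 6 * config 3 + 2 * config 4 = D * (D - 1)\<^sup>2"
    using config_sum by (simp add: p_int range orbits)
  have one: "config 1 = D * (D - 1)"
    by (rule config_1)
  have pos1: "0 \<le> config 1 + (s - 1) * config 2 - (1 + s) * config 3 + config 4"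
    using autocorrelation_nonneg[of "\<lambda>i. [0, 2, s, -1, 1, 0, -s, s, 0, -1, 1, -s, -2] ! nat (i mod 13)"]
    by (simp add: p_int range orbits algebra_simps s2 s3)
  have pos2: "0 \<le> config 1 + 2 * config 2 - 2 * config 3 - config 4"
    using autocorrelation_nonneg[of "\<lambda>i. [0, 2, 1, -1, -1, -2, 1, 1, -2, -1, -1, 1, 2] ! nat (i mod 13)"]
    by (simp add: p_int range orbits algebra_simps)
  have "s \<le> 2" unfolding s_def by (rule real_le_lsqrt) auto
  \<comment> \<open>These multipliers make the coefficients of \<open>config 3\<close> and \<open>config 4\<close> proportional to those in \<open>total\<close>.\<close>
  then have "0 \<le> (23 - 9 * s) * (config 1 + (s - 1) * config 2 - (1 + s) * config 3 + config 4)
      + 13 * (5 - s) * (config 1 + 2 * config 2 - 2 * config 3 - config 4)"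
    using pos1 pos2
    by (intro add_nonneg_nonneg[OF mult_nonneg_nonneg mult_nonneg_nonneg]) simp_all
  moreover have "config 4 = (D * (D - 1)\<^sup>2 - config 1 - 3 * config 2 - 6 * config 3) / 2"
    using total by simp
  ultimately show ?thesis
    using config_2_le unfolding s_def[symmetric]
    by (simp add: one field_simps power2_eq_square power3_eq_cube s2 s3)
qed

text \<open>The orbits of 3 and 4 have six ratios each, and the two counts enter
  \<open>total\<close> with equal coefficients and likewise \<open>pos\<close>. So adding three
  times \<open>pos\<close> to \<open>total\<close> eliminates both at once.\<close>

lemma aps_ge_17:
  assumes p: "p = 17"
  shows "1 / 24 * D ^ 3 - 1 / 4 * D ^ 2 + 5 / 24 * D
    \<le> real aps"
proof -
  have p_int: "int p = 17" by (simp add: p)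
  have range: "{1..<17::int} = {1, 2, 3, 4, 5, 6, 7, 8, 9, 10, 11, 12, 13, 14, 15, 16}"
    by (simp add: atLeastLessThan_int_rec)
  have inverse: "config 2 = config 9" "config 3 = config 6" "config 8 = config 15"
    "config 10 = config 12" "config 4 = config 13" "config 5 = config 7" "config 11 = config 14"
    by (rule config_inverse; simp add: p_int cong_def)+
  have reflect: "config 2 = config 16" "config 3 = config 15" "config 6 = config 12" "config 4 = config 14" "config 5 = config 13"
    by (rule config_reflect_cong; simp add: p_int cong_def)+
  have orbits: "config 9 = config 2" "config 16 = config 2" "config 6 = config 3"
    "config 8 = config 3" "config 10 = config 3" "config 12 = config 3" "config 15 = config 3"
    "config 5 = config 4" "config 7 = config 4" "config 11 = config 4" "config 13 = config 4"
    "config 14 = config 4"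
    using inverse reflect by linarith+
  have total: "config 1 + 3 * config 2 + 6 * config 3 + 6 * config 4 = D * (D - 1)\<^sup>2"
    using config_sum by (simp add: p_int range orbits)
  have one: "config 1 = D * (D - 1)"
    by (rule config_1)
  have pos: "0 \<le> config 1 + 3 * config 2 - 2 * config 3 - 2 * config 4"
    using autocorrelation_nonneg[of "\<lambda>i.
      [0, 1, 1, -1, 1, -1, -1, -1, 1, 1, -1, -1, -1, 1, -1, 1, 1] ! nat (i mod 17)"]
    by (simp add: p_int range orbits algebra_simps)
  show ?thesis
    using total config_2_le pos
    by (simp add: one algebra_simps power2_eq_square power3_eq_cube)
qed

end

section \<open>Transfer to the minimum over all subsets\<close>

text \<open>A bound valid for every subset holds for a minimising one; this supplies that subset as
  an instance of the locale.\<close>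

lemma W3_attained_residue_subset:
  assumes "D \<le> p" "prime p" "p > 3"
  obtains S where "residue_subset p S" "residue_subset.D S = real D"
    "residue_subset.aps p S = W3 p D"
proof -
  obtain S where S: "S \<subseteq> carrier (Zmod p)" "card S = D"
    "W3 p D = card {A \<in> three_term_APs p. A \<subseteq> S}"
    using W3_attained[OF assms(1)] by blast
  have "S \<subseteq> {0..<int p}" using S(1) by (auto simp: residue_ring_def)
  then have R: "residue_subset p S" using assms by unfold_locales
  show thesis
    using that[OF R] S by (simp add: residue_subset.D_def[OF R] residue_subset.aps_def[OF R])
qed

theorem theorem2:
  shows "(\<forall>D::nat. D \<le> 5 \<longrightarrow>
            real (W3 5 D) \<ge> (real D ^ 3 - 3 * real D ^ 2 + 2 * real D) / 6) \<and>
         (\<forall>D::nat. D \<le> 7 \<longrightarrow>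
            real (W3 7 D) \<ge> (real D ^ 3 - 4 * real D ^ 2 + 3 * real D) / 8) \<and>
         (\<forall>D::nat. D \<le> 11 \<longrightarrow>
            real (W3 11 D) \<ge> (sqrt 5 * real D ^ 3 + (15 - 12 * sqrt 5) * real D ^ 2
                                 + (- 15 + 11 * sqrt 5) * real D) / 30) \<and>
         (\<forall>D::nat. D \<le> 13 \<longrightarrow>
            real (W3 13 D) \<ge> (21 - 2 * sqrt 3) / 286 * real D ^ 3
                                 + (28 * sqrt 3 - 151) / 286 * real D ^ 2
                                 + (5 - sqrt 3) / 11 * real D) \<and>
         (\<forall>D::nat. D \<le> 17 \<longrightarrow>
            real (W3 17 D) \<ge> 1 / 24 * real D ^ 3 - 1 / 4 * real D ^ 2 + 5 / 24 * real D)"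
proof (intro conjI allI impI)
  fix D :: nat assume "D \<le> 5"
  then obtain S where S: "residue_subset 5 S" "residue_subset.D S = real D"
    "residue_subset.aps 5 S = W3 5 D"
    by (rule W3_attained_residue_subset) simp_all
  show "real (W3 5 D) \<ge> (real D ^ 3 - 3 * real D ^ 2 + 2 * real D) / 6"
    using residue_subset.aps_ge_5[OF S(1) refl] by (simp only: S)
next
  fix D :: nat assume "D \<le> 7"
  then obtain S where S: "residue_subset 7 S" "residue_subset.D S = real D"
    "residue_subset.aps 7 S = W3 7 D"
    by (rule W3_attained_residue_subset) simp_all
  show "real (W3 7 D) \<ge> (real D ^ 3 - 4 * real D ^ 2 + 3 * real D) / 8"
    using residue_subset.aps_ge_7[OF S(1) refl] by (simp only: S)
next
  fix D :: nat assume "D \<le> 11"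
  then obtain S where S: "residue_subset 11 S" "residue_subset.D S = real D"
    "residue_subset.aps 11 S = W3 11 D"
    by (rule W3_attained_residue_subset) simp_all
  show "real (W3 11 D) \<ge> (sqrt 5 * real D ^ 3 + (15 - 12 * sqrt 5) * real D ^ 2 + (- 15 + 11 * sqrt 5) * real D) / 30"
    using residue_subset.aps_ge_11[OF S(1) refl] by (simp only: S)
next
  fix D :: nat assume "D \<le> 13"
  then obtain S where S: "residue_subset 13 S" "residue_subset.D S = real D"
    "residue_subset.aps 13 S = W3 13 D"
    by (rule W3_attained_residue_subset) simp_all
  show "real (W3 13 D) \<ge> (21 - 2 * sqrt 3) / 286 * real D ^ 3 + (28 * sqrt 3 - 151) / 286 * real D ^ 2 + (5 - sqrt 3) / 11 * real D"
    using residue_subset.aps_ge_13[OF S(1) refl] by (simp only: S)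
next
  fix D :: nat assume "D \<le> 17"
  then obtain S where S: "residue_subset 17 S" "residue_subset.D S = real D"
    "residue_subset.aps 17 S = W3 17 D"
    by (rule W3_attained_residue_subset) simp_all
  show "real (W3 17 D) \<ge> 1 / 24 * real D ^ 3 - 1 / 4 * real D ^ 2 + 5 / 24 * real D"
    using residue_subset.aps_ge_17[OF S(1) refl] by (simp only: S)
qed

end
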